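(* Let $G=(V,E)$ be a connected graph of order $n$ and diameter $d \geq 3$ such that every spanning tree $T$ of $G$ is a caterpillar of diameter $d$. Then $\xi^{c}(G) \geq \xi^{c}(V_{n,d})$.
   Context: All graphs are finite, simple and connected. For a vertex $v$, $\epsilon(v)=\max_{u} d(u,v)$ is its eccentricity ($d(u,v)$ the shortest-path distance) and ${\rm d}(v)$ its degree. The eccentric connectivity index is $\xi^{c}(G) = \sum_{v \in V(G)} \epsilon(v)\,{\rm d}(v)$. A caterpillar is a tree in which every vertex is within distance one of a central path. The volcano graph $V_{n,d}$ is obtained from a path $P_{d+1}$ and a set $S$ of $n-d-1$ further vertices by joining each vertex of $S$ to a central vertex of $P_{d+1}$ (the unique middle vertex if $d$ is even, one of the two middle vertices if $d$ is odd); its eccentric connectivity index does not depend on these choices and equals $nd+n+\frac{d^{2}}{2}-2d-1$ for $d$ even and $nd+2n+\frac{d^{2}}{2}-3d-\frac{3}{2}$ for $d$ odd. *)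

theory Defs
  imports "Graph_Theory.Graph_Theory"
begin

text \<open>
  Finite simple graphs are represented as finite, loop-free, symmetric digraphs whose arcs are
  pairs of vertices, i.e. by the locale \<^locale>\<open>pair_graph\<close>. Each edge is present as two
  opposite arcs, so the degree of a vertex is its out-degree.
\<close>

text \<open>
  On \<^typ>\<open>nat\<close> the infimum of the empty set is \<open>0\<close>, so the distance is meaningful only for
  vertices joined by a walk, in particular for all vertices of a connected graph.
\<close>

definition gdist :: "'a pair_pre_digraph \<Rightarrow> 'a \<Rightarrow> 'a \<Rightarrow> nat" where
  "gdist G u v = (INF p \<in> {p. pre_digraph.awalk (with_proj G) u p v}. length p)"

definition eccentricity :: "'a pair_pre_digraph \<Rightarrow> 'a \<Rightarrow> nat" where
  "eccentricity G v = Max ((\<lambda>u. gdist G u v) ` pverts G)"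

definition diameter :: "'a pair_pre_digraph \<Rightarrow> nat" where
  "diameter G = Max (eccentricity G ` pverts G)"

definition eccentric_connectivity_index :: "'a pair_pre_digraph \<Rightarrow> nat" where
  "eccentric_connectivity_index G
     = (\<Sum>v \<in> pverts G. eccentricity G v * out_degree (with_proj G) v)"

text \<open>
  In a symmetric digraph the closed walk \<open>a, b, a\<close> along an edge is a cycle in the sense of
  \<^const>\<open>pre_digraph.cycle\<close>, so \<^const>\<open>Digraph_Component.tree\<close> and
  \<^const>\<open>Digraph_Component.spanning_tree\<close> do not describe undirected trees. The cycles of the
  undirected graph are those of length at least three. As for graphs, spanning trees are required
  to be symmetric (through \<^locale>\<open>pair_graph\<close>).
\<close>

definition undirected_tree :: "'a pair_pre_digraph \<Rightarrow> bool" where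
  "undirected_tree T \<longleftrightarrow> pair_graph T \<and> connected (with_proj T) \<and>
     \<not> (\<exists>p. pre_digraph.cycle (with_proj T) p \<and> 3 \<le> length p)"

definition undirected_spanning_tree ::
    "'a pair_pre_digraph \<Rightarrow> 'a pair_pre_digraph \<Rightarrow> bool" where
  "undirected_spanning_tree T G \<longleftrightarrow> undirected_tree T \<and> spanning (with_proj T) (with_proj G)"

definition caterpillar :: "'a pair_pre_digraph \<Rightarrow> bool" where
  "caterpillar T \<longleftrightarrow> undirected_tree T \<and>
     (\<exists>xs. vpath xs (with_proj T) \<and> (\<forall>v \<in> pverts T. \<exists>u \<in> set xs. gdist T u v \<le> 1))"

text \<open>
  The volcano graph on \<open>{0..<n}\<close>, meant for \<open>n \<ge> d + 1\<close>: the path is \<open>0, 1, \<dots>, d\<close> and each of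
  the remaining vertices \<open>s\<close> is joined to \<open>c s\<close>, a central vertex of the path. For even \<open>d\<close> the two
  elements of \<open>path_centres d\<close> coincide.
\<close>

definition path_centres :: "nat \<Rightarrow> nat set" where
  "path_centres d = {d div 2, (d + 1) div 2}"

definition volcano :: "nat \<Rightarrow> nat \<Rightarrow> (nat \<Rightarrow> nat) \<Rightarrow> nat pair_pre_digraph" where
  "volcano n d c =
     \<lparr>pverts = {0..<n},
      parcs = symcl ({(i, i + 1) | i. i < d} \<union> {(s, c s) | s. s \<in> {d + 1..<n}})\<rparr>"

lemma pair_graph_volcano:
  assumes "d + 1 \<le> n" and "c ` {d + 1..<n} \<subseteq> path_centres d"
  shows "pair_graph (volcano n d c)"
proof -
  have c: "c s < s" if "Suc d \<le> s" "s < n" for s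
  proof -
    have "c s \<in> path_centres d" using assms(2) that by auto
    then show ?thesis using that by (auto simp: path_centres_def)
  qed
  let ?S = "{(i, i + 1) | i. i < d} \<union> {(s, c s) | s. s \<in> {d + 1..<n}}"
  let ?R = "symcl ?S"
  have S: "fst e < n \<and> snd e < n \<and> fst e \<noteq> snd e" if e: "e \<in> ?S" for e
  proof -
    from e consider i where "e = (i, i + 1)" "i < d"
      | s where "e = (s, c s)" "Suc d \<le> s" "s < n" by auto
    then show ?thesis
    proof cases
      case 1 then show ?thesis using assms(1) by simp
    next
      case (2 s) then show ?thesis using c[of s] by simp
    qed
  qed
  have R: "fst e < n \<and> snd e < n \<and> fst e \<noteq> snd e" if e: "e \<in> ?R" for e
  proof (cases "e \<in> ?S")
    case True then show ?thesis by (rule S)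
  next
    case False
    with e have "(snd e, fst e) \<in> ?S" unfolding symcl_def by (auto split: prod.splits)
    from S[OF this] show ?thesis by simp
  qed
  define A where "A = ?R"
  have A: "fst e < n \<and> snd e < n \<and> fst e \<noteq> snd e" if "e \<in> A" for e
    using R that unfolding A_def by blast
  have sub: "A \<subseteq> {0..<n} \<times> {0..<n}"
  proof
    fix e assume "e \<in> A"
    from A[OF this] show "e \<in> {0..<n} \<times> {0..<n}" by (cases e) simp
  qed
  have fin: "finite A"
    by (rule finite_subset[OF sub]) simp
  have "sym (symcl r)" for r :: "nat rel"
    by (auto simp: symcl_def sym_def image_iff)
  then have sym: "sym A"
    unfolding A_def .
  have V: "volcano n d c = \<lparr>pverts = {0..<n}, parcs = A\<rparr>"
    unfolding volcano_def A_def ..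
  show ?thesis
    unfolding V by unfold_locales (use A fin sym in \<open>auto simp: symmetric_def\<close>)
qed

end

theory Submission
  imports Defs
begin

text \<open>
  Write the index as the sum of \<open>\<epsilon>(u) + \<epsilon>(v)\<close> over the edges \<open>uv\<close>, let \<open>r = \<lceil>d/2\<rceil>\<close>, and fix a
  shortest path between vertices \<open>s\<close> and \<open>t\<close> at distance \<open>d\<close>. Its edges contribute at least
  as much as the path edges of the volcano graph, so it is enough that each of the other vertices
  accounts for \<open>2 r + 1\<close>. Let \<open>a\<close> and \<open>b\<close> be the distances to \<open>s\<close> and \<open>t\<close>; then \<open>a + b \<ge> d\<close> and
  \<open>max a b \<le> \<epsilon>\<close>, hence \<open>\<epsilon> \<ge> r\<close>. A vertex with \<open>a < r\<close> is charged an edge towards \<open>s\<close>, whose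
  other end has \<open>b > r\<close>; a vertex with \<open>b < r \<le> a\<close> is charged an edge towards \<open>t\<close>, whose other end
  has \<open>a > r\<close>. If \<open>a = b = r\<close>, the vertex has two distinct edges, one towards \<open>s\<close> and one towards \<open>t\<close>,
  and both are charged to it (\<open>4 r \<ge> 2 r + 1\<close>). In the remaining case \<open>\<epsilon> > r\<close>, and any one edge
  would do: take one towards \<open>s\<close>. No edge is charged from both of its ends.
\<close>

section \<open>Distances\<close>

lemma gdist_le:
  assumes "pre_digraph.awalk (with_proj G) u p v"
  shows "gdist G u v \<le> length p"
  unfolding gdist_def using assms by (intro cINF_lower) auto

text \<open>A nonempty set of naturals contains its infimum. The given walk excludes the default
  value \<open>0\<close> of the empty infimum.\<close>

lemma gdist_attained:
  assumes "pre_digraph.awalk (with_proj G) u p v"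
  obtains q where "pre_digraph.awalk (with_proj G) u q v" "length q = gdist G u v"
proof -
  let ?W = "{p. pre_digraph.awalk (with_proj G) u p v}"
  have "length ` ?W \<noteq> {}" using assms by auto
  from Inf_nat_def1[OF this] show thesis
    using that by (auto simp: gdist_def)
qed

lemma length_rev_path [simp]: "length (rev_path p) = length p"
  by (induction p) auto

lemma (in pair_sym_digraph) gdist_commute: "gdist G u v = gdist G v u"
proof -
  have "length ` {p. awalk u p v} \<subseteq> length ` {p. awalk v p u}" for u v
    by (metis (mono_tags, lifting) awalk_rev_path image_eqI image_subsetI length_rev_path mem_Collect_eq)
  then have "length ` {p. awalk u p v} = length ` {p. awalk v p u}" by blast
  then show ?thesis unfolding gdist_def by simp
qed

lemma (in pair_fin_digraph) gdist_le_eccentricity: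
  "u \<in> pverts G \<Longrightarrow> gdist G u v \<le> eccentricity G v"
  unfolding eccentricity_def using finite_verts by (intro Max_ge) auto

text \<open>Here walks join all pairs of vertices, so \<open>gdist\<close> is a genuine metric on
  \<open>pverts G\<close>.\<close>

locale connected_pair_graph = pair_graph +
  assumes connected: "connected (with_proj G)"
begin

lemma pverts_nonempty: "pverts G \<noteq> {}"
  using connected by (auto simp: connected_conv)

lemma awalk_exists:
  assumes "u \<in> pverts G" "v \<in> pverts G"
  obtains p where "awalk u p v"
proof -
  have "symmetric (with_proj G)" by (rule sym_arcs)
  then have "strongly_connected (with_proj G)"
    using connected by (rule symmetric_connected_imp_strongly_connected)
  then have "reachable (with_proj G) u v"
    using assms by (auto simp: strongly_connected_def)
  then show thesis using that reachable_awalk by auto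
qed

lemma shortest_awalk:
  assumes "u \<in> pverts G" "v \<in> pverts G"
  obtains p where "awalk u p v" "length p = gdist G u v"
  using awalk_exists[OF assms] gdist_attained by metis

lemma gdist_triangle:
  assumes "u \<in> pverts G" "v \<in> pverts G" "w \<in> pverts G"
  shows "gdist G u w \<le> gdist G u v + gdist G v w"
proof -
  obtain p where p: "awalk u p v" "length p = gdist G u v"
    using shortest_awalk assms by metis
  obtain q where q: "awalk v q w" "length q = gdist G v w"
    using shortest_awalk assms by metis
  have "gdist G u w \<le> length (p @ q)"
    using p q by (intro gdist_le) (rule awalk_appendI)
  then show ?thesis using p q by simp
qed

lemma gdist_eq_0_iff:
  assumes "u \<in> pverts G" "v \<in> pverts G"
  shows "gdist G u v = 0 \<longleftrightarrow> u = v"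
proof
  assume "gdist G u v = 0"
  then show "u = v" using shortest_awalk[OF assms] by (metis awalk_empty_ends length_0_conv)
next
  assume "u = v"
  then have "awalk u [] v" using assms by (simp add: awalk_Nil_iff)
  then show "gdist G u v = 0" using gdist_le[of G u "[]" v] by simp
qed

text \<open>The second vertex of a shortest walk serves as \<open>w\<close>: the rest of the walk
  has length \<open>k\<close>, and anything shorter would, after prepending the first arc, beat the
  minimum \<open>Suc k\<close>.\<close>

lemma gdist_step:
  assumes "u \<in> pverts G" "v \<in> pverts G" "gdist G u v = Suc k"
  obtains w where "(u, w) \<in> parcs G" "gdist G w v = k"
proof -
  obtain p where p: "awalk u p v" "length p = Suc k"
    using shortest_awalk assms by metis
  then obtain e q where eq: "p = e # q" "length q = k" by (cases p) auto
  with p have e: "e \<in> parcs G" "fst e = u" "awalk (snd e) q v"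
    by (auto simp: awalk_Cons_iff)
  obtain q' where q': "awalk (snd e) q' v" "length q' = gdist G (snd e) v"
    using gdist_attained e(3) by metis
  have "awalk u (e # q') v" using e q' by (simp add: awalk_Cons_iff)
  then have "Suc k \<le> Suc (gdist G (snd e) v)"
    using gdist_le[of G u "e # q'" v] assms(3) q'(2) by simp
  moreover have "gdist G (snd e) v \<le> k" using gdist_le[OF e(3)] eq by simp
  ultimately show thesis using that[of "snd e"] e by auto
qed

text \<open>Iterates \<open>gdist_step\<close>. Indexing the vertices by position allows sums over
  \<open>i\<close>, and the recorded distances to \<open>v\<close> later make the path
  injective.\<close>

lemma geodesic:
  assumes "u \<in> pverts G" "v \<in> pverts G" "gdist G u v = k"
  shows "\<exists>x. x 0 = u \<and> x k = v \<and> (\<forall>i<k. (x i, x (Suc i)) \<in> parcs G)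
    \<and> (\<forall>i\<le>k. x i \<in> pverts G \<and> gdist G (x i) v = k - i)"
  using assms
proof (induction k arbitrary: u)
  case 0
  have "u = v" using gdist_eq_0_iff[OF 0(1,2)] 0(3) by (rule iffD1)
  then show ?case using 0 by (intro exI[of _ "\<lambda>_. u"]) simp
next
  case (Suc k)
  obtain w where w: "(u, w) \<in> parcs G" "gdist G w v = k"
    by (rule gdist_step[OF Suc.prems])
  have "w \<in> pverts G" using w(1) by (rule in_arcsD2)
  from Suc.IH[OF this Suc.prems(2) w(2)]
  obtain x where x: "x 0 = w" "x k = v" "\<forall>i<k. (x i, x (Suc i)) \<in> parcs G"
    "\<forall>i\<le>k. x i \<in> pverts G \<and> gdist G (x i) v = k - i"
    by blast
  show ?case
  proof (intro exI[of _ "case_nat u x"] conjI allI impI)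
    fix i
    show "(case_nat u x i, case_nat u x (Suc i)) \<in> parcs G" if "i < Suc k"
      using that w x by (cases i) auto
    show "case_nat u x i \<in> pverts G" if "i \<le> Suc k"
      using that x Suc.prems by (cases i) auto
    show "gdist G (case_nat u x i) v = Suc k - i" if "i \<le> Suc k"
      using that x Suc.prems by (cases i) auto
  qed (use x in auto)
qed

lemma diameter_attained:
  obtains u v where "u \<in> pverts G" "v \<in> pverts G" "gdist G u v = diameter G"
proof -
  have "diameter G \<in> eccentricity G ` pverts G"
    unfolding diameter_def using finite_verts pverts_nonempty by (intro Max_in) auto
  then obtain v where v: "v \<in> pverts G" "diameter G = eccentricity G v" by auto
  have "eccentricity G v \<in> (\<lambda>u. gdist G u v) ` pverts G"
    unfolding eccentricity_def using finite_verts pverts_nonempty by (intro Max_in) auto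
  then show thesis using that v by auto
qed

end


section \<open>The index as a sum over edges\<close>

text \<open>Grouping the arcs by their tail counts each vertex as often as its degree.\<close>

lemma (in pair_fin_digraph) eccentric_connectivity_index_arcs:
  "eccentric_connectivity_index G = (\<Sum>e\<in>parcs G. eccentricity G (fst e))"
proof -
  have "eccentricity G v * out_degree G v
      = (\<Sum>e\<in>{e \<in> parcs G. fst e = v}. eccentricity G (fst e))" for v
    by (simp add: out_degree_def out_arcs_def)
  then have "eccentric_connectivity_index G
      = (\<Sum>v\<in>pverts G. \<Sum>e\<in>{e \<in> parcs G. fst e = v}. eccentricity G (fst e))"
    unfolding eccentric_connectivity_index_def by (intro sum.cong refl)
  also have "\<dots> = (\<Sum>e\<in>parcs G. eccentricity G (fst e))"
    by (rule sum.group) (use finite_verts finite_arcs in_arcsD1 in auto)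
  finally show ?thesis .
qed

text \<open>\<open>D\<close> orients a selection of edges, none in both directions. Hence
  \<open>D\<close> and its converse are disjoint sets of arcs, and the remaining arcs only add to
  the index.\<close>

lemma (in pair_pseudo_graph) eccentric_connectivity_index_ge:
  assumes "D \<subseteq> parcs G" "D \<inter> D\<inverse> = {}"
  shows "(\<Sum>(u, v)\<in>D. eccentricity G u + eccentricity G v) \<le> eccentric_connectivity_index G"
proof -
  have fin: "finite D" using assms(1) finite_arcs finite_subset by blast
  have "(\<Sum>(u, v)\<in>D. eccentricity G u + eccentricity G v)
      = (\<Sum>e\<in>D. eccentricity G (fst e)) + (\<Sum>e\<in>D. eccentricity G (snd e))"
    by (simp add: case_prod_beta sum.distrib)
  also have "(\<Sum>e\<in>D. eccentricity G (snd e)) = (\<Sum>e\<in>D\<inverse>. eccentricity G (fst e))"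
    by (rule sum.reindex_bij_witness[of _ prod.swap prod.swap]) auto
  also have "(\<Sum>e\<in>D. eccentricity G (fst e)) + (\<Sum>e\<in>D\<inverse>. eccentricity G (fst e))
      = (\<Sum>e\<in>D \<union> D\<inverse>. eccentricity G (fst e))"
    using fin assms(2) by (intro sum.union_disjoint[symmetric]) auto
  also have "\<dots> \<le> (\<Sum>e\<in>parcs G. eccentricity G (fst e))"
    using assms(1) arcs_symmetric finite_arcs by (intro sum_mono2) auto
  finally show ?thesis by (simp add: eccentric_connectivity_index_arcs)
qed

text \<open>An edge listed by \<open>D\<close> in both directions is merely overcounted, which
  respects an upper bound.\<close>

lemma (in pair_fin_digraph) eccentric_connectivity_index_le:
  assumes "parcs G = symcl D" "finite D"
  shows "eccentric_connectivity_index G \<le> (\<Sum>(u, v)\<in>D. eccentricity G u + eccentricity G v)"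
proof -
  have "eccentric_connectivity_index G = (\<Sum>e\<in>D \<union> prod.swap ` D. eccentricity G (fst e))"
    unfolding eccentric_connectivity_index_arcs assms(1)
    by (rule sum.cong) (force simp: symcl_def)+
  also have "\<dots> \<le> (\<Sum>e\<in>D. eccentricity G (fst e)) + (\<Sum>e\<in>prod.swap ` D. eccentricity G (fst e))"
    using sum.union_inter[of D "prod.swap ` D" "\<lambda>e. eccentricity G (fst e)"] assms(2) by simp
  also have "(\<Sum>e\<in>prod.swap ` D. eccentricity G (fst e)) = (\<Sum>e\<in>D. eccentricity G (snd e))"
    by (simp add: sum.reindex)
  finally show ?thesis by (simp add: case_prod_beta sum.distrib)
qed


section \<open>Lower bound in terms of order and diameter\<close>

text \<open>The sum over \<open>i\<close> is the weight of a path with \<open>d\<close> edges whose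
  vertex \<open>i\<close> has eccentricity \<open>max i (d - i)\<close>. The factor
  \<open>2 * r + 1\<close> is \<open>(r + 1) + r\<close>, a leaf together with the centre it hangs
  from.\<close>

lemma (in connected_pair_graph) eccentric_connectivity_index_lower_bound:
  fixes d r :: nat
  assumes diam: "diameter G = d" and "3 \<le> d" and r: "r = (d + 1) div 2"
  shows "d + 1 \<le> card (pverts G)"
    and "(\<Sum>i<d. max i (d - i) + max (Suc i) (d - Suc i)) + (card (pverts G) - (d + 1)) * (2 * r + 1)
      \<le> eccentric_connectivity_index G"
proof -
  obtain s t where st: "s \<in> pverts G" "t \<in> pverts G" "gdist G s t = d"
    using diameter_attained diam by metis
  obtain x where x: "x 0 = s" "x d = t" "\<And>i. i < d \<Longrightarrow> (x i, x (Suc i)) \<in> parcs G"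
    "\<And>i. i \<le> d \<Longrightarrow> x i \<in> pverts G" "\<And>i. i \<le> d \<Longrightarrow> gdist G (x i) t = d - i"
    using geodesic[OF st] by auto
  define a where "a v = gdist G v s" for v
  define b where "b v = gdist G v t" for v
  define \<epsilon> where "\<epsilon> = eccentricity G"
  have ab: "d \<le> a v + b v" if "v \<in> pverts G" for v
    using gdist_triangle[OF st(1) that st(2)] st(3) gdist_commute[of s v] by (simp add: a_def b_def)
  have \<epsilon>: "a v \<le> \<epsilon> v \<and> b v \<le> \<epsilon> v" for v
    using gdist_le_eccentricity[OF st(1), of v] gdist_le_eccentricity[OF st(2), of v]
      gdist_commute[of v s] gdist_commute[of v t] by (simp add: a_def b_def \<epsilon>_def)
  let ?P = "x ` {..d}"
  have P: "?P \<subseteq> pverts G" using x by auto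
  \<comment> \<open>The position \<open>i\<close> can be recovered from the distance
    \<open>d - i\<close> to \<open>t\<close>.\<close>
  have inj: "inj_on x {..d}"
    by (rule inj_onI) (metis x(5) atMost_iff diff_diff_cancel)
  have cardP: "card ?P = d + 1" using card_image[OF inj] by simp
  show "d + 1 \<le> card (pverts G)"
    using card_mono[OF _ P] finite_verts cardP by simp
  \<comment> \<open>Since \<open>x i\<close> has distance \<open>d - i\<close> to \<open>t\<close>,
    \<open>ab\<close> forces distance at least \<open>i\<close> to \<open>s\<close>.\<close>
  have \<epsilon>x: "max i (d - i) \<le> \<epsilon> (x i)" if "i \<le> d" for i
    using \<epsilon>[of "x i"] ab[OF x(4)[OF that]] x(5)[OF that] that by (auto simp: b_def)
  have "\<exists>p. (w, p) \<in> parcs G \<and> Suc (a p) = a w" if w: "w \<in> pverts G" "w \<notin> ?P" for w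
  proof -
    have "w \<noteq> s" using x(1) w by auto
    then have "gdist G w s \<noteq> 0" using gdist_eq_0_iff[OF w(1) st(1)] by simp
    then obtain k where k: "gdist G w s = Suc k" by (cases "gdist G w s") auto
    obtain y where "(w, y) \<in> parcs G" "gdist G y s = k"
      by (rule gdist_step[OF w(1) st(1) k])
    with k show ?thesis unfolding a_def by auto
  qed
  then obtain p where p: "\<And>w. w \<in> pverts G \<Longrightarrow> w \<notin> ?P \<Longrightarrow> (w, p w) \<in> parcs G \<and> Suc (a (p w)) = a w"
    by metis
  have "\<exists>p. (w, p) \<in> parcs G \<and> Suc (b p) = b w" if w: "w \<in> pverts G" "w \<notin> ?P" for w
  proof -
    have "w \<noteq> t" using x(2) w by auto
    then have "gdist G w t \<noteq> 0" using gdist_eq_0_iff[OF w(1) st(2)] by simp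
    then obtain k where k: "gdist G w t = Suc k" by (cases "gdist G w t") auto
    obtain y where "(w, y) \<in> parcs G" "gdist G y t = k"
      by (rule gdist_step[OF w(1) st(2) k])
    with k show ?thesis unfolding b_def by auto
  qed
  then obtain q where q: "\<And>w. w \<in> pverts G \<Longrightarrow> w \<notin> ?P \<Longrightarrow> (w, q w) \<in> parcs G \<and> Suc (b (q w)) = b w"
    by metis
  define R where "R = pverts G - ?P"
  have Rp: "w \<in> pverts G" "p w \<in> pverts G" "(w, p w) \<in> parcs G" "Suc (a (p w)) = a w" 
    and Rq: "q w \<in> pverts G" "(w, q w) \<in> parcs G" "Suc (b (q w)) = b w" if "w \<in> R" for w
    using p[of w] q[of w] in_arcsD2 that by (auto simp: R_def)
  \<comment> \<open>\<open>N w\<close> holds the far ends of the edges charged to \<open>w\<close>;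
    \<open>p\<close> steps towards \<open>s\<close> and \<open>q\<close> towards
    \<open>t\<close>.\<close>
  define N where "N w = (if a w < r then {p w} else if b w < r then {q w}
    else if a w = r \<and> b w = r then {p w, q w} else {p w})" for w
  define D1 where "D1 = (\<lambda>i. (x i, x (Suc i))) ` {..<d}"
  define D2 where "D2 = Sigma R N"
  have finR: "finite R" using finite_verts by (simp add: R_def)
  have finN: "finite (N w)" for w by (simp add: N_def)
  have D1P: "D1 \<subseteq> ?P \<times> ?P" by (auto simp: D1_def)
  have D2R: "fst e \<in> R" if "e \<in> D2" for e using that by (auto simp: D2_def)
  have "D1 \<union> D2 \<subseteq> parcs G"
    using x(3) Rp Rq by (auto simp: D1_def D2_def N_def split: if_splits)
  moreover have "(D1 \<union> D2) \<inter> (D1 \<union> D2)\<inverse> = {}"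
  proof -
    have "D1 \<inter> D1\<inverse> = {}"
    proof -
      have "i < d \<Longrightarrow> j < d \<Longrightarrow> x i = x (Suc j) \<Longrightarrow> x j = x (Suc i) \<Longrightarrow> False" for i j
        using inj_onD[OF inj, of i "Suc j"] inj_onD[OF inj, of j "Suc i"] by simp
      then show ?thesis by (auto simp: D1_def) metis
    qed
    moreover have "D1 \<inter> D2\<inverse> = {}" "D2 \<inter> D1\<inverse> = {}"
      using D1P D2R by (force simp: R_def)+
    \<comment> \<open>If both ends charge the edge towards the same target, the distance to it would
      drop in both directions. If \<open>y\<close> charges it towards \<open>t\<close> and
      \<open>w\<close> towards \<open>s\<close>, then \<open>b y \<le> r \<le> a y\<close> gives
      \<open>b w < r < a w\<close>, and such a \<open>w\<close> charges only towards
      \<open>t\<close>. The other mixed case is this one with \<open>w\<close> and \<open>y\<close>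
      exchanged.\<close>
    moreover have "False" if "w \<in> R" "y \<in> R" "y \<in> N w" "w \<in> N y" for w y
      using that Rp[OF that(1)] Rq[OF that(1)] Rp[OF that(2)] Rq[OF that(2)]
        ab[of w] ab[of y] r
      by (auto simp: N_def split: if_splits)
    then have "D2 \<inter> D2\<inverse> = {}" by (auto simp: D2_def)
    ultimately show ?thesis by auto
  qed
  ultimately have "(\<Sum>(u, v)\<in>D1 \<union> D2. \<epsilon> u + \<epsilon> v) \<le> eccentric_connectivity_index G"
    unfolding \<epsilon>_def by (rule eccentric_connectivity_index_ge)
  moreover have "(\<Sum>(u, v)\<in>D1 \<union> D2. \<epsilon> u + \<epsilon> v)
      = (\<Sum>(u, v)\<in>D1. \<epsilon> u + \<epsilon> v) + (\<Sum>(u, v)\<in>D2. \<epsilon> u + \<epsilon> v)"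
  proof (rule sum.union_disjoint)
    show "D1 \<inter> D2 = {}" using D1P D2R by (force simp: R_def)
  qed (use finR finN in \<open>auto simp: D1_def D2_def\<close>)
  moreover have "(\<Sum>i<d. max i (d - i) + max (Suc i) (d - Suc i)) \<le> (\<Sum>(u, v)\<in>D1. \<epsilon> u + \<epsilon> v)"
  proof -
    have "inj_on (\<lambda>i. (x i, x (Suc i))) {..<d}"
      using inj by (auto simp: inj_on_def)
    then have "(\<Sum>(u, v)\<in>D1. \<epsilon> u + \<epsilon> v) = (\<Sum>i<d. \<epsilon> (x i) + \<epsilon> (x (Suc i)))"
      by (simp add: D1_def sum.reindex)
    moreover have "(\<Sum>i<d. max i (d - i) + max (Suc i) (d - Suc i)) \<le> \<dots>"
      by (intro sum_mono add_mono \<epsilon>x) auto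
    ultimately show ?thesis by simp
  qed
  moreover have "(card (pverts G) - (d + 1)) * (2 * r + 1) \<le> (\<Sum>(u, v)\<in>D2. \<epsilon> u + \<epsilon> v)"
  proof -
    have bound: "2 * r + 1 \<le> (\<Sum>y\<in>N w. \<epsilon> w + \<epsilon> y)" if w: "w \<in> R" for w
    proof -
      note facts = Rp[OF w] Rq[OF w] ab[OF Rp(1)[OF w]] ab[OF Rp(2)[OF w]] ab[OF Rq(1)[OF w]]
        \<epsilon>[of w] \<epsilon>[of "p w"] \<epsilon>[of "q w"]
      consider "a w < r" | "r \<le> a w" "b w < r" | "a w = r" "b w = r"
        | "r \<le> a w" "r \<le> b w" "a w \<noteq> r \<or> b w \<noteq> r" by linarith
      then show ?thesis
      proof cases
        case 3
        \<comment> \<open>A common value would have distance \<open>r - 1\<close> to both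
          \<open>s\<close> and \<open>t\<close>, but \<open>2 * r - 2 < d\<close>.\<close>
        have "p w \<noteq> q w" using facts 3 r by auto
        then show ?thesis using 3 facts r \<open>3 \<le> d\<close> by (simp add: N_def)
      qed (use facts r in \<open>auto simp: N_def\<close>)
    qed
    have "card R = card (pverts G) - (d + 1)"
      unfolding R_def using P cardP finite_verts by (simp add: card_Diff_subset)
    then have "(card (pverts G) - (d + 1)) * (2 * r + 1) = (\<Sum>w\<in>R. 2 * r + 1)" by simp
    also have "\<dots> \<le> (\<Sum>w\<in>R. \<Sum>y\<in>N w. \<epsilon> w + \<epsilon> y)" by (intro sum_mono bound)
    also have "\<dots> = (\<Sum>(u, v)\<in>D2. \<epsilon> u + \<epsilon> v)"
      unfolding D2_def using finR finN by (intro sum.Sigma) auto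
    finally show ?thesis .
  qed
  ultimately show "(\<Sum>i<d. max i (d - i) + max (Suc i) (d - Suc i))
      + (card (pverts G) - (d + 1)) * (2 * r + 1) \<le> eccentric_connectivity_index G"
    by linarith
qed


section \<open>Upper bound for the volcano graph\<close>

text \<open>Eccentricities are only bounded from above, so exhibiting walks is enough.\<close>

lemma eccentric_connectivity_index_volcano_le:
  fixes n d r :: nat
  assumes "d + 1 \<le> n" and "3 \<le> d" and c: "c ` {d + 1..<n} \<subseteq> path_centres d"
    and r: "r = (d + 1) div 2"
  shows "eccentric_connectivity_index (volcano n d c)
    \<le> (\<Sum>i<d. max i (d - i) + max (Suc i) (d - Suc i)) + (n - (d + 1)) * (2 * r + 1)"
proof -
  let ?V = "volcano n d c"
  interpret pair_graph ?V using assms by (intro pair_graph_volcano) auto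
  define D1 where "D1 = (\<lambda>i. (i, Suc i)) ` {..<d}"
  define D2 where "D2 = (\<lambda>s. (s, c s)) ` {d + 1..<n}"
  have verts: "pverts ?V = {0..<n}" by (simp add: volcano_def)
  have arcs: "parcs ?V = symcl (D1 \<union> D2)"
  proof -
    have "{(i, i + 1) | i. i < d} = D1" "{(s, c s) | s. s \<in> {d + 1..<n}} = D2"
      by (auto simp: D1_def D2_def)
    then show ?thesis unfolding volcano_def by (metis pair_pre_digraph.select_convs(2))
  qed
  have c': "c s = d div 2 \<or> c s = (d + 1) div 2" if "d + 1 \<le> s" "s < n" for s
  proof -
    have "c s \<in> path_centres d" using c that by auto
    then show ?thesis by (auto simp: path_centres_def)
  qed

  define W where "W u v k \<longleftrightarrow> (\<exists>p. awalk u p v \<and> length p = k)" for u v k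
  have W_le: "gdist ?V u v \<le> k" if "W u v l" "l \<le> k" for u v k l
    using that gdist_le[of ?V u _ v] unfolding W_def by (auto intro: order_trans)
  have W_trans: "W u w (k + l)" if "W u v k" "W v w l" for u v w k l
    using that unfolding W_def by (metis awalk_appendI length_append)
  have W_sym: "W u v k \<Longrightarrow> W v u k" for u v k
    unfolding W_def by (metis awalk_rev_path length_rev_path)
  have W_refl: "W u u 0" if "u < n" for u
    unfolding W_def using that by (auto simp: awalk_Nil_iff verts)
  have W_arc: "W u v 1" if "(u, v) \<in> parcs ?V" for u v
    unfolding W_def using arc_implies_awalk[OF that] by force
  have W_hill: "W i (i + k) k" if "i + k \<le> d" for i k
    using that
  proof (induction k)
    case 0 then show ?case using W_refl \<open>d + 1 \<le> n\<close> by simp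
  next
    case (Suc k)
    have "(i + k, i + Suc k) \<in> parcs ?V" using Suc.prems by (auto simp: arcs symcl_def D1_def)
    from W_trans[OF Suc.IH W_arc[OF this]] show ?case using Suc.prems by simp
  qed
  \<comment> \<open>The difference of \<open>max\<close> and \<open>min\<close> is the absolute
    difference of two naturals.\<close>
  have W_path: "W i j (max i j - min i j)" if "i \<le> d" "j \<le> d" for i j
    using W_hill[of i "j - i"] W_sym[OF W_hill[of j "i - j"]] that
    by (cases "i \<le> j") auto
  have W_leaf: "W s (c s) 1" if "d + 1 \<le> s" "s < n" for s
    using that by (intro W_arc) (auto simp: arcs symcl_def D2_def)
  have c_le: "c s \<le> d" if "d + 1 \<le> s" "s < n" for s
    using c'[OF that] \<open>3 \<le> d\<close> by auto
  have leaf_path: "W s i (1 + (max (c s) i - min (c s) i))" if "d + 1 \<le> s" "s < n" "i \<le> d" for s i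
    by (rule W_trans[OF W_leaf W_path]) (use that c_le in auto)
  have leaf_leaf: "W s s' (1 + (max (c s) (c s') - min (c s) (c s')) + 1)"
    if "d + 1 \<le> s" "s < n" "d + 1 \<le> s'" "s' < n" for s s'
    by (rule W_trans[OF leaf_path W_sym[OF W_leaf]]) (use that c_le in auto)

  have ecc_path: "eccentricity ?V i \<le> max i (d - i)" if "i \<le> d" for i
  proof -
    have "gdist ?V u i \<le> max i (d - i)" if "u < n" for u
    proof (cases "u \<le> d")
      case True
      show ?thesis by (rule W_le[OF W_path]) (use True \<open>i \<le> d\<close> in auto)
    next
      case False
      then have u: "d + 1 \<le> u" "u < n" using that by auto
      \<comment> \<open>As \<open>3 \<le> d\<close>, each centre has a path edge on either side. So
        the leaf, one step beyond its centre, is no farther from \<open>i\<close> than the path end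
        on that side.\<close>
      show ?thesis
        by (rule W_le[OF leaf_path]) (use u \<open>i \<le> d\<close> c'[OF u] \<open>3 \<le> d\<close> in auto)
    qed
    then show ?thesis
      unfolding eccentricity_def verts using \<open>d + 1 \<le> n\<close> by (intro Max.boundedI) auto
  qed
  have ecc_leaf: "eccentricity ?V s \<le> r + 1" if s: "d + 1 \<le> s" "s < n" for s
  proof -
    have "gdist ?V u s \<le> r + 1" if "u < n" for u
    proof (cases "u \<le> d")
      case True
      show ?thesis
        by (rule W_le[OF W_sym[OF leaf_path]]) (use True s c'[OF s] r in auto)
    next
      case False
      then have u: "d + 1 \<le> u" "u < n" using that by auto
      \<comment> \<open>Two centres differ by at most \<open>1\<close>, so two leaves are joined by
        a walk of length at most \<open>3\<close>, and \<open>2 \<le> r\<close> because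
        \<open>3 \<le> d\<close>.\<close>
      show ?thesis
        by (rule W_le[OF leaf_leaf]) (use u s c'[OF u] c'[OF s] r \<open>3 \<le> d\<close> in auto)
    qed
    then show ?thesis
      unfolding eccentricity_def verts using \<open>d + 1 \<le> n\<close> by (intro Max.boundedI) auto
  qed
  have ecc_centre: "eccentricity ?V (c s) \<le> r" if s: "d + 1 \<le> s" "s < n" for s
    using ecc_path[OF c_le[OF s]] c'[OF s] r by auto

  have "eccentric_connectivity_index ?V
      \<le> (\<Sum>(u, v)\<in>D1 \<union> D2. eccentricity ?V u + eccentricity ?V v)"
    by (rule eccentric_connectivity_index_le[OF arcs]) (simp add: D1_def D2_def)
  also have "\<dots> = (\<Sum>(u, v)\<in>D1. eccentricity ?V u + eccentricity ?V v)
      + (\<Sum>(u, v)\<in>D2. eccentricity ?V u + eccentricity ?V v)"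
    by (rule sum.union_disjoint) (auto simp: D1_def D2_def)
  also have "\<dots> \<le> (\<Sum>i<d. max i (d - i) + max (Suc i) (d - Suc i)) + (\<Sum>s\<in>{d + 1..<n}. 2 * r + 1)"
  proof (rule add_mono)
    have "(\<Sum>(u, v)\<in>D1. eccentricity ?V u + eccentricity ?V v)
        = (\<Sum>i<d. eccentricity ?V i + eccentricity ?V (Suc i))"
      by (simp add: D1_def sum.reindex inj_on_def)
    also have "\<dots> \<le> (\<Sum>i<d. max i (d - i) + max (Suc i) (d - Suc i))"
      by (intro sum_mono add_mono ecc_path) auto
    finally show "(\<Sum>(u, v)\<in>D1. eccentricity ?V u + eccentricity ?V v)
        \<le> (\<Sum>i<d. max i (d - i) + max (Suc i) (d - Suc i))" .
    have "(\<Sum>(u, v)\<in>D2. eccentricity ?V u + eccentricity ?V v)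
        = (\<Sum>s\<in>{d + 1..<n}. eccentricity ?V s + eccentricity ?V (c s))"
      by (simp add: D2_def sum.reindex inj_on_def)
    also have "\<dots> \<le> (\<Sum>s\<in>{d + 1..<n}. 2 * r + 1)"
    proof (rule sum_mono)
      fix s assume "s \<in> {d + 1..<n}"
      then show "eccentricity ?V s + eccentricity ?V (c s) \<le> 2 * r + 1"
        using ecc_leaf[of s] ecc_centre[of s] by simp
    qed
    finally show "(\<Sum>(u, v)\<in>D2. eccentricity ?V u + eccentricity ?V v)
        \<le> (\<Sum>s\<in>{d + 1..<n}. 2 * r + 1)" .
  qed
  finally show ?thesis by simp
qed

theorem theorem1:
  fixes G :: "'a pair_pre_digraph" and n d :: nat and c :: "nat \<Rightarrow> nat"
  assumes "pair_graph G" and "connected (with_proj G)"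
    and "card (pverts G) = n" and "diameter G = d" and "d \<ge> 3"
    and "\<forall>T. undirected_spanning_tree T G \<longrightarrow> caterpillar T \<and> diameter T = d"
    and "c ` {d + 1..<n} \<subseteq> path_centres d"
  shows "eccentric_connectivity_index G \<ge> eccentric_connectivity_index (volcano n d c)"
proof -
  interpret connected_pair_graph G
    using assms(1,2) by (simp add: connected_pair_graph_def connected_pair_graph_axioms_def)
  \<comment> \<open>With \<open>refl\<close> fixing \<open>r\<close> as \<open>(d + 1) div 2\<close>
    in both lemmas, the two bounds are the same expression, so it is never evaluated by the parity
    of \<open>d\<close>.\<close>
  note lower = eccentric_connectivity_index_lower_bound[OF assms(4,5) refl, unfolded assms(3)]
  show ?thesis
    using eccentric_connectivity_index_volcano_le[OF lower(1) assms(5,7) refl] lower(2)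
    by (rule order_trans)
qed

end
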